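(* Let $k\ge 2$ be an integer. Let $G$ be a finite simple graph that is $k$-connected and is a $[k+1,2]$-graph. Then $G$ is hamiltonian-connected unless $G$ is isomorphic to $kK_1\vee G_k$ for some graph $G_k$ of order $k$.
   Context: For integers $s,t$, a graph $G$ is an $[s,t]$-graph if every induced subgraph of $G$ on $s$ vertices has at least $t$ edges. A graph is hamiltonian-connected if for any two distinct vertices $x,y$ there is a path with endpoints $x$ and $y$ containing every vertex of the graph. $kK_1$ denotes the edgeless graph on $k$ vertices, and for graphs $G,H$, the join $G\vee H$ is obtained from the disjoint union of $G$ and $H$ by adding all edges between a vertex of $G$ and a vertex of $H$. $G_k$ is an arbitrary graph on $k$ vertices. *)

theory Defs
  imports "Graph_Theory.Graph_Theory"
begin

text \<open>
  A finite simple graph is a \<^locale>\<open>pair_graph\<close>: a finite symmetric loop-free digraph without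
  parallel arcs. An undirected edge corresponds to two opposite arcs, so edges are counted as
  vertex sets \<open>{u, v}\<close>.
\<close>

definition num_edges :: "('a, 'b) pre_digraph \<Rightarrow> nat" where
  "num_edges G = card {{u, v} |u v. u \<rightarrow>\<^bsub>G\<^esub> v}"

definition st_graph :: "nat \<Rightarrow> nat \<Rightarrow> ('a, 'b) pre_digraph \<Rightarrow> bool" where
  "st_graph s t G \<longleftrightarrow> (\<forall>S \<subseteq> verts G. card S = s \<longrightarrow> t \<le> num_edges (G \<restriction> S))"

text \<open>
  The condition on the order is the usual convention by which the complete graph on
  \<open>n\<close> vertices is \<open>k\<close>-connected exactly for \<open>k < n\<close>.
\<close>

definition k_connected :: "nat \<Rightarrow> ('a, 'b) pre_digraph \<Rightarrow> bool" where
  "k_connected k G \<longleftrightarrow> k < card (verts G) \<and>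
     (\<forall>X \<subseteq> verts G. card X < k \<longrightarrow> Digraph_Component.connected (G \<restriction> (verts G - X)))"

definition hamiltonian_connected :: "('a, 'b) pre_digraph \<Rightarrow> bool" where
  "hamiltonian_connected G \<longleftrightarrow>
     (\<forall>x \<in> verts G. \<forall>y \<in> verts G. x \<noteq> y \<longrightarrow>
        (\<exists>p. vpath p G \<and> hd p = x \<and> last p = y \<and> set p = verts G))"

definition edgeless :: "nat \<Rightarrow> nat pair_pre_digraph" where
  "edgeless k = \<lparr> pverts = {..<k}, parcs = {} \<rparr>"

definition graph_join ::
  "'a pair_pre_digraph \<Rightarrow> 'b pair_pre_digraph \<Rightarrow> ('a + 'b) pair_pre_digraph" where
  "graph_join G H =
     \<lparr> pverts = pverts G <+> pverts H,
       parcs = {(Inl u, Inl v) |u v. (u, v) \<in> parcs G}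
             \<union> {(Inr u, Inr v) |u v. (u, v) \<in> parcs H}
             \<union> {(Inl u, Inr v) |u v. u \<in> pverts G \<and> v \<in> pverts H}
             \<union> {(Inr v, Inl u) |u v. u \<in> pverts G \<and> v \<in> pverts H} \<rparr>"

end

theory Submission
  imports Defs "HOL-Library.Multiset"
begin

text \<open>
  Suppose that no Hamiltonian path joins \<open>x\<close> to \<open>y\<close>. Take a longest \<open>x\<close>--\<open>y\<close> path \<open>P\<close>, a component \<open>H\<close>
  of \<open>G - P\<close> and a vertex \<open>h\<close> of \<open>H\<close>. As in the Chvatal--Erdos argument, \<open>H\<close> has at least \<open>k\<close>
  neighbours on \<open>P\<close>, and \<open>h\<close> together with the successors of these neighbours on \<open>P\<close> is an
  independent set \<open>S\<close>. The edge condition says that independent sets have at most \<open>k\<close> vertices and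
  that every vertex outside an independent \<open>k\<close>-set has two neighbours in it; this forces \<open>|S| = k\<close>,
  makes \<open>x\<close> and \<open>y\<close> neighbours of \<open>H\<close>, and shows that \<open>h\<close> is the only vertex missed by \<open>P\<close>.

  The neighbours of \<open>h\<close> cut \<open>P\<close> into segments. If a segment contains two vertices \<open>s, v, ...\<close>, then
  \<open>v\<close> is adjacent to a second successor \<open>s'\<close>, and rerouting through \<open>h\<close> and the edge \<open>v s'\<close> gives
  either a Hamiltonian path or another longest path that misses \<open>s\<close> only and has a long segment
  closer to \<open>y\<close>, so induction excludes this. Hence neighbours and non-neighbours of \<open>h\<close>
  alternate on \<open>P\<close>, the non-neighbours form \<open>S\<close>, and since all degrees are at least \<open>k\<close>, every
  vertex of \<open>S\<close> is adjacent to all \<open>k\<close> vertices outside \<open>S\<close>.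
\<close>

section \<open>Successors on a path\<close>

fun succs :: "'a list \<Rightarrow> 'a set \<Rightarrow> 'a set" where
  "succs (p # q # r) X = (if p \<in> X then {q} else {}) \<union> succs (q # r) X"
| "succs _ X = {}"

lemma succs_append:
  "succs (A @ B) X = succs A X \<union> succs B X \<union>
     (if A \<noteq> [] \<and> B \<noteq> [] \<and> last A \<in> X then {hd B} else {})"
proof (induction A)
  case (Cons p A)
  then show ?case by (cases A; cases B) auto
qed auto

lemma succs_subset_tl: "succs P X \<subseteq> set (tl P)"
  by (induction P X rule: succs.induct) auto

lemma succs_subset: "succs P X \<subseteq> set P"
  using succs_subset_tl by (metis list.set_sel(2) subset_eq tl_Nil)

lemma finite_succs: "finite (succs P X)"
  by (rule finite_subset[OF succs_subset]) simp

lemma succs_disjoint: "set P \<inter> X = {} \<Longrightarrow> succs P X = {}"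
  by (induction P X rule: succs.induct) auto

lemma succs_split:
  "s \<in> succs P X \<Longrightarrow> \<exists>A u B. P = A @ [u, s] @ B \<and> u \<in> X"
proof (induction P X rule: succs.induct)
  case (1 p q r X)
  show ?case
  proof (cases "p \<in> X \<and> s = q")
    case True
    then have "p # q # r = [] @ [p, s] @ r" by simp
    then show ?thesis using True by blast
  next
    case False
    then have "s \<in> succs (q # r) X" using 1(2) by (auto split: if_splits)
    from 1(1)[OF this] obtain A u B where "q # r = A @ [u, s] @ B" "u \<in> X" by blast
    then have "p # q # r = (p # A) @ [u, s] @ B" by simp
    then show ?thesis using \<open>u \<in> X\<close> by blast
  qed
qed auto

lemma succsE:
  assumes "s \<in> succs P X"
  obtains A u B where "P = A @ [u, s] @ B" "u \<in> X"
  using succs_split[OF assms] by (elim exE conjE) (rule that)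

lemma in_succs: "u \<in> X \<Longrightarrow> s \<in> succs (A @ [u, s] @ B) X"
  by (simp add: succs_append)

lemma succs_iff_pred:
  assumes "distinct (A @ [u, s] @ B)"
  shows "s \<in> succs (A @ [u, s] @ B) X \<longleftrightarrow> u \<in> X"
  using assms succs_subset_tl[of "s # B" X] succs_subset[of "A @ [u]" X]
    succs_append[of "A @ [u]" "s # B" X]
  by (auto split: if_splits)

text \<open>On a list without repetitions the successor map is injective and is undefined only at
  the last entry, hence \<open>butlast\<close>.\<close>

lemma card_succs: "distinct P \<Longrightarrow> card (succs P X) = card (set (butlast P) \<inter> X)"
proof (induction P X rule: succs.induct)
  case (1 p q r X)
  have "q \<notin> succs (q # r) X" using 1(2) succs_subset_tl[of "q # r" X] by auto
  moreover have "p \<notin> set (butlast (q # r))" using 1(2) in_set_butlastD by fastforce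
  ultimately show ?case using 1 by (auto simp: finite_succs)
qed auto

lemma rtranclp_distinct_path:
  assumes "r\<^sup>*\<^sup>* a b"
  shows "\<exists>R. R \<noteq> [] \<and> hd R = a \<and> last R = b \<and> successively r R \<and> distinct R \<and> (\<forall>v\<in>set R. r\<^sup>*\<^sup>* a v)"
  using assms
proof (induction rule: rtranclp_induct)
  case base
  show ?case by (rule exI[of _ "[a]"]) simp
next
  case (step b c)
  then obtain R where R: "R \<noteq> []" "hd R = a" "last R = b" "successively r R" "distinct R"
    "\<forall>v\<in>set R. r\<^sup>*\<^sup>* a v" by (elim exE conjE) (rule that)
  show ?case
  proof (cases "c \<in> set R")
    case True
    \<comment> \<open>The new endpoint already lies on the path, so the path is cut back
      there.\<close>
    then obtain R1 R2 where "R = R1 @ c # R2" by (meson split_list)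
    then show ?thesis using R
      by (intro exI[of _ "R1 @ [c]"])
        (auto simp: successively_append_iff successively_Cons hd_append split: if_splits)
  next
    case False
    have "r\<^sup>*\<^sup>* a c" using step(1,2) by simp
    with False show ?thesis using R step(2)
      by (intro exI[of _ "R @ [c]"]) (auto simp: successively_append_iff)
  qed
qed

section \<open>Longest paths\<close>

text \<open>The graph hypotheses in adjacency form. Connectivity of \<open>V - X\<close> reads: a
  nonempty part closed under adjacency is everything. In \<open>two_nbrs\<close> the k+1 vertices
  are an independent set and \<open>v\<close>, so both edges granted by the edge condition end in
  \<open>v\<close>.\<close>

locale kc_graph =
  fixes V :: "'a set" and E :: "'a \<Rightarrow> 'a \<Rightarrow> bool" and k :: nat
  assumes fin: "finite V"
    and E_sym: "E u v \<Longrightarrow> E v u"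
    and E_irrefl: "\<not> E u u"
    and E_verts: "E u v \<Longrightarrow> u \<in> V"
    and k2: "2 \<le> k"
    and k_less: "k < card V"
    and no_small_cut: "\<lbrakk>X \<subseteq> V; card X < k; C \<subseteq> V - X; C \<noteq> {};
        \<And>u w. \<lbrakk>u \<in> C; w \<in> V - X; E u w\<rbrakk> \<Longrightarrow> w \<in> C\<rbrakk> \<Longrightarrow> C = V - X"
    and two_nbrs: "\<lbrakk>S \<subseteq> V; card S = k; \<And>u w. \<lbrakk>u \<in> S; w \<in> S\<rbrakk> \<Longrightarrow> \<not> E u w; v \<in> V - S\<rbrakk>
        \<Longrightarrow> \<exists>a\<in>S. \<exists>b\<in>S. a \<noteq> b \<and> E v a \<and> E v b"
begin

lemma E_comm: "E u v \<longleftrightarrow> E v u"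
  using E_sym by blast

lemma E_verts2: "E u v \<Longrightarrow> v \<in> V"
  using E_sym E_verts by blast

lemma successively_converse_E [simp]: "successively (\<lambda>u v. E v u) xs \<longleftrightarrow> successively E xs"
proof -
  have "(\<lambda>u v. E v u) = E" using E_comm by (intro ext) blast
  then show ?thesis by (rule arg_cong)
qed

lemma successively_rev_E: "successively E (rev xs) \<longleftrightarrow> successively E xs"
  by simp

definition nbrs :: "'a \<Rightarrow> 'a set" where
  "nbrs h = {v. E h v}"

lemma nbrs_iff [simp]: "v \<in> nbrs h \<longleftrightarrow> E h v"
  by (simp add: nbrs_def)

lemma nbrs_subset: "nbrs h \<subseteq> V"
  using E_verts2 by auto

definition path :: "'a \<Rightarrow> 'a \<Rightarrow> 'a list \<Rightarrow> bool" where
  "path x y P \<longleftrightarrow> P \<noteq> [] \<and> hd P = x \<and> last P = y \<and> successively E P \<and> distinct P \<and> set P \<subseteq> V"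

definition longest :: "'a \<Rightarrow> 'a \<Rightarrow> 'a list \<Rightarrow> bool" where
  "longest x y P \<longleftrightarrow> path x y P \<and> (\<forall>Q. path x y Q \<longrightarrow> length Q \<le> length P)"

lemma longestD:
  assumes "longest x y P"
  shows "P \<noteq> []" "hd P = x" "last P = y" "successively E P" "distinct P" "set P \<subseteq> V"
  using assms unfolding longest_def path_def by auto

lemma path_rev: "path x y P \<Longrightarrow> path y x (rev P)"
  unfolding path_def by (auto simp: hd_rev last_rev)

lemma longest_rev: "longest x y P \<Longrightarrow> longest y x (rev P)"
  unfolding longest_def by (metis path_rev length_rev)

text \<open>The multiset equation yields at once that \<open>Q\<close> is repetition-free, stays in
  \<open>V\<close> and is longer than \<open>P\<close>; a rerouting then needs only its adjacencies
  and its ends checked.\<close>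

lemma longest_no_extension:
  assumes "longest x y P" "R \<noteq> []" "set R \<subseteq> V - set P" "distinct R"
    and "mset Q = mset (P @ R)" "successively E Q" "hd Q = x" "last Q = y"
  shows False
proof -
  note P = longestD[OF assms(1)]
  have "distinct Q"
    using mset_eq_imp_distinct_iff[OF assms(5)] P(5) assms(3,4) by auto
  moreover have "set Q = set P \<union> set R" using mset_eq_setD[OF assms(5)] by simp
  moreover have l: "length Q = length P + length R"
    using mset_eq_length[OF assms(5)] by simp
  ultimately have "path x y Q" unfolding path_def using P assms by auto
  then show False using assms(1,2) l unfolding longest_def by fastforce
qed

lemma longest_no_extension1:
  assumes "longest x y P" "h \<in> V - set P"
    and "mset Q = mset (h # P)" "successively E Q" "hd Q = x" "last Q = y"
  shows False
  using longest_no_extension[of x y P "[h]" Q] assms by simp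

text \<open>Trading \<open>h\<close> for \<open>s\<close> keeps the length, so maximality passes to
  \<open>Q\<close>. This lets \<open>no_long_segment\<close> induct over longest paths.\<close>

lemma longest_exchange:
  assumes "longest x y P" "h \<in> V - set P" "s \<in> V"
    and "mset (s # Q) = mset (h # P)" "successively E Q" "hd Q = x" "last Q = y" "Q \<noteq> []"
  shows "longest x y Q" "s \<in> V - set Q"
proof -
  note P = longestD[OF assms(1)]
  have "distinct (s # Q)"
    using mset_eq_imp_distinct_iff[OF assms(4)] P(5) assms(2) by auto
  moreover have "set (s # Q) = set (h # P)" using mset_eq_setD[OF assms(4)] by simp
  moreover have l: "length Q = length P"
    using mset_eq_length[OF assms(4)] by simp
  ultimately have "path x y Q" unfolding path_def using P assms by auto
  then show "longest x y Q" using assms(1) l unfolding longest_def by auto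
  show "s \<in> V - set Q" using \<open>distinct (s # Q)\<close> assms(3) by simp
qed

section \<open>Detours through connected sets off the path\<close>

definition linked :: "'a set \<Rightarrow> bool" where
  "linked H \<longleftrightarrow> (\<forall>a\<in>H. \<forall>b\<in>H. \<exists>R. R \<noteq> [] \<and> hd R = a \<and> last R = b \<and>
     successively E R \<and> distinct R \<and> set R \<subseteq> H)"

lemma linked_singleton: "linked {h}"
  unfolding linked_def by (auto intro!: exI[of _ "[h]"])

text \<open>The set may contain vertices of \<open>H\<close> too; what matters is its trace on a
  path avoiding \<open>H\<close>.\<close>

definition attach :: "'a set \<Rightarrow> 'a set" where
  "attach H = {u. \<exists>w\<in>H. E w u}"

lemma attach_singleton: "attach {h} = nbrs h"
  by (auto simp: attach_def)

lemma linked_through: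
  assumes "linked H" "u \<in> attach H" "w \<in> attach H"
  obtains R where "R \<noteq> []" "E u (hd R)" "E (last R) w" "successively E R" "distinct R" "set R \<subseteq> H"
proof -
  obtain a b where "a \<in> H" "E a u" "b \<in> H" "E b w" using assms by (auto simp: attach_def)
  moreover then obtain R where "R \<noteq> []" "hd R = a" "last R = b"
     "successively E R" "distinct R" "set R \<subseteq> H" using assms(1) unfolding linked_def by blast
  ultimately show ?thesis using that[of R] E_sym by auto
qed

text \<open>Replacing the edge from \<open>u\<close> to \<open>w\<close> by a detour through
  \<open>H\<close> would lengthen \<open>P\<close>.\<close>

lemma attach_not_consecutive:
  assumes l: "longest x y P" and H: "linked H" "H \<subseteq> V - set P"
    and P: "P = A @ [u, w] @ B" and u: "u \<in> attach H" and w: "w \<in> attach H"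
  shows False
proof -
  obtain R where R: "R \<noteq> []" "E u (hd R)" "E (last R) w" "successively E R" "distinct R" "set R \<subseteq> H"
    using linked_through[OF H(1) u w] .
  note D = longestD[OF l]
  have "successively E (A @ [u] @ R @ [w] @ B)"
    using R D(4) by (cases B) (auto simp: P successively_append_iff successively_Cons hd_append split: if_splits)
  then show False
  proof (rule longest_no_extension[OF l, rotated 4])
    show "mset (A @ [u] @ R @ [w] @ B) = mset (P @ R)"
      by (simp add: P)
    show "hd (A @ [u] @ R @ [w] @ B) = x" "last (A @ [u] @ R @ [w] @ B) = y"
      using D(2,3) by (auto simp add: P hd_append split: if_splits)
    show "set R \<subseteq> V - set P" "distinct R" "R \<noteq> []"
      using R H by auto
  qed
qed

text \<open>\<open>L\<close> runs from the earlier of the two successors to the predecessor of the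
  later one, \<open>t'\<close>. Which of \<open>s\<close>, \<open>t\<close> comes first is unknown,
  hence the final disjunction.\<close>

lemma cross_decompose:
  assumes d: "distinct P" and s: "s \<in> succs P X" and t: "t \<in> succs P X" and "s \<noteq> t"
  obtains A u L t' C where "P = A @ [u] @ L @ [t'] @ C" "L \<noteq> []" "u \<in> X" "last L \<in> X"
    "hd L = s \<and> t' = t \<or> hd L = t \<and> t' = s"
proof -
  obtain A w C where P: "P = A @ [w, t] @ C" and w: "w \<in> X" using t by (rule succsE)
  have "P = (A @ [w]) @ (t # C)" by (simp add: P)
  then have "s \<in> succs (A @ [w]) X \<or> s \<in> succs (t # C) X"
    using s \<open>s \<noteq> t\<close> by (simp only: succs_append[of "A @ [w]" "t # C" X]) (auto split: if_splits)
  then show ?thesis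
  proof
    assume "s \<in> succs (A @ [w]) X"
    then obtain A1 u A2 where 1: "A @ [w] = A1 @ [u, s] @ A2" and u: "u \<in> X"
      by (rule succsE)
    have "P = (A @ [w]) @ [t] @ C" by (simp add: P)
    then have "P = A1 @ [u] @ (s # A2) @ [t] @ C" unfolding 1 by simp
    moreover have "last (s # A2) = w" using arg_cong[OF 1, of last] by simp
    ultimately show ?thesis using u w by (intro that[of A1 u "s # A2" t C]) simp_all
  next
    assume "s \<in> succs (t # C) X"
    then obtain C1 u C2 where 1: "t # C = C1 @ [u, s] @ C2" and u: "u \<in> X"
      by (rule succsE)
    have "P = A @ [w] @ (t # C)" by (simp add: P)
    then have "P = A @ [w] @ (C1 @ [u]) @ [s] @ C2" unfolding 1 by simp
    moreover have "hd (C1 @ [u]) = t" using arg_cong[OF 1, of hd] by (simp add: hd_append split: if_splits)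
    ultimately show ?thesis using u w by (intro that[of A w "C1 @ [u]" s C2]) simp_all
  qed
qed

text \<open>Go along \<open>P\<close> to \<open>u\<close>, cross \<open>H\<close> to
  \<open>last L\<close>, return along \<open>L\<close> to the earlier successor, pass through
  \<open>Z\<close> to the later one and on to \<open>y\<close>: this is longer than
  \<open>P\<close>. Empty \<open>Z\<close> excludes an edge between the successors, a singleton
  \<open>Z\<close> a common neighbour off \<open>P\<close> and \<open>H\<close>.\<close>

lemma attach_succs_no_link:
  assumes l: "longest x y P" and H: "linked H" "H \<subseteq> V - set P"
    and s: "s \<in> succs P (attach H)" and t: "t \<in> succs P (attach H)" and "s \<noteq> t"
    and Z: "distinct Z" "set Z \<subseteq> V - set P - H" "successively E (s # Z @ [t])"
  shows False
proof -
  note D = longestD[OF l]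
  obtain A u L t' C where
    P: "P = A @ [u] @ L @ [t'] @ C" "L \<noteq> []"
     and u: "u \<in> attach H" and v: "last L \<in> attach H"
     and st: "hd L = s \<and> t' = t \<or> hd L = t \<and> t' = s"
    by (rule cross_decompose[OF D(5) s t \<open>s \<noteq> t\<close>])
  obtain Z' where Z': "distinct Z'" "set Z' \<subseteq> V - set P - H" "successively E (hd L # Z' @ [t'])"
  proof (cases "hd L = s")
    case True
    then have "t' = t" using st \<open>s \<noteq> t\<close> by auto
    show ?thesis by (rule that[OF Z(1,2)]) (use Z(3) True \<open>t' = t\<close> in simp)
  next
    case False
    then have *: "hd L = t" "t' = s" using st by auto
    have "successively E (rev (s # Z @ [t]))" using Z(3) by (simp only: successively_rev_E)
    then show ?thesis using * Z(1,2) by (intro that[of "rev Z"]) simp_all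
  qed
  obtain R where R: "R \<noteq> []" "E u (hd R)" "E (last R) (last L)" "successively E R" "distinct R" "set R \<subseteq> H"
    using linked_through[OF H(1) u v] .
  define W where "W = Z' @ [t']"
  have W: "W \<noteq> []" "last W = t'" "successively E W" "E (hd L) (hd W)"
    using Z'(3) by (simp_all add: W_def successively_Cons)
  have L: "successively E L" "successively E A" "A \<noteq> [] \<Longrightarrow> E (last A) u" "successively E C" "C \<noteq> [] \<Longrightarrow> E t' (hd C)"
    using D(4) by (auto simp: P(1) successively_append_iff successively_Cons)
  have "successively E ((A @ [u]) @ R @ rev L @ W @ C)"
    using R L W P(2) E_sym by (auto simp: successively_append_iff successively_Cons hd_append hd_rev last_rev)
  then have "successively E (A @ [u] @ R @ rev L @ Z' @ [t'] @ C)"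
    by (simp add: W_def)
  then show False
  proof (rule longest_no_extension[OF l, rotated 4])
    show "mset (A @ [u] @ R @ rev L @ Z' @ [t'] @ C) = mset (P @ R @ Z')"
      by (simp add: P(1))
    show "hd (A @ [u] @ R @ rev L @ Z' @ [t'] @ C) = x"
      "last (A @ [u] @ R @ rev L @ Z' @ [t'] @ C) = y"
      using D(2,3) by (auto simp add: P(1) hd_append split: if_splits)
    show "set (R @ Z') \<subseteq> V - set P" "distinct (R @ Z')" "R @ Z' \<noteq> []"
      using R H Z' by auto
  qed
qed

text \<open>In a larger independent set, a vertex outside a k-element subset would have two
  neighbours in that subset.\<close>

lemma independent_card_le:
  assumes "S \<subseteq> V" "\<And>u w. \<lbrakk>u \<in> S; w \<in> S\<rbrakk> \<Longrightarrow> \<not> E u w"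
  shows "card S \<le> k"
proof (rule ccontr)
  assume "\<not> card S \<le> k"
  obtain T where T: "T \<subseteq> S" "card T = k" "finite T"
    by (rule obtain_subset_with_card_n[of k S]) (use \<open>\<not> card S \<le> k\<close> in simp)
  have "T \<noteq> S" using T(2) \<open>\<not> card S \<le> k\<close> by auto
  then obtain v where "v \<in> S" "v \<notin> T" using T(1) by auto
  then show False using two_nbrs[of T v] T assms by blast
qed

text \<open>\<open>r\<close> steps inside \<open>U\<close> only, which makes \<open>H\<close> the
  component of \<open>h\<close> in the subgraph induced on \<open>U\<close>.\<close>

lemma linked_component:
  assumes "h \<in> U" and r: "r = (\<lambda>a b. E a b \<and> a \<in> U \<and> b \<in> U)" and H: "H = {w. r\<^sup>*\<^sup>* h w}"
  shows "linked H" "h \<in> H" "H \<subseteq> U" "\<And>a b. \<lbrakk>a \<in> H; E a b; b \<in> U\<rbrakk> \<Longrightarrow> b \<in> H"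
proof -
  show "h \<in> H" by (simp add: H)
  show HU: "H \<subseteq> U"
  proof
    fix w assume "w \<in> H"
    then have "r\<^sup>*\<^sup>* h w" by (simp add: H)
    then show "w \<in> U" by (induction rule: rtranclp_induct) (auto simp: r \<open>h \<in> U\<close>)
  qed
  show "b \<in> H" if "a \<in> H" "E a b" "b \<in> U" for a b
  proof -
    have "r a b" using that HU by (auto simp: r)
    then show ?thesis using that(1) by (auto simp: H)
  qed
  have "symp r" by (auto simp: r symp_def E_sym)
  then have sym: "symp r\<^sup>*\<^sup>*" by (rule symp_rtranclp)
  show "linked H" unfolding linked_def
  proof (intro ballI)
    fix a b assume "a \<in> H" "b \<in> H"
    then have ha: "r\<^sup>*\<^sup>* h a" and "r\<^sup>*\<^sup>* h b" by (simp_all add: H)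
    then have "r\<^sup>*\<^sup>* a b" using sym by (metis rtranclp_trans sympD)
    from rtranclp_distinct_path[OF this] obtain R where R: "R \<noteq> []" "hd R = a" "last R = b"
      "successively r R" "distinct R" "\<forall>v\<in>set R. r\<^sup>*\<^sup>* a v" by (elim exE conjE) (rule that)
    have "successively E R" using R(4) by (rule successively_mono) (auto simp: r)
    moreover have "set R \<subseteq> H"
      using R(6) ha by (auto simp: H intro: rtranclp_trans)
    ultimately show "\<exists>R. R \<noteq> [] \<and> hd R = a \<and> last R = b \<and>
      successively E R \<and> distinct R \<and> set R \<subseteq> H" using R by blast
  qed
qed

text \<open>All facts come from equality in k <= |X| <= |S| <= k, where \<open>X\<close> holds the
  neighbours of the component on \<open>P\<close> and \<open>S\<close> consists of \<open>h\<close>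
  and their successors.\<close>

lemma longest_missing:
  assumes l: "longest x y P" and "x \<noteq> y" and h: "h \<in> V - set P"
  shows "set P = V - {h}" "card (nbrs h) = k" "E h y" "card (insert h (succs P (nbrs h))) = k"
    "\<And>s t. \<lbrakk>s \<in> insert h (succs P (nbrs h)); t \<in> insert h (succs P (nbrs h))\<rbrakk> \<Longrightarrow> \<not> E s t"
proof -
  note D = longestD[OF l]
  define r where "r = (\<lambda>a b. E a b \<and> a \<in> V - set P \<and> b \<in> V - set P)"
  define H where "H = {w. r\<^sup>*\<^sup>* h w}"
  note C = linked_component[OF h r_def H_def]
  have cons: "\<not> (u \<in> attach H \<and> w \<in> attach H)" if "P = A @ [u, w] @ B" for u w A B
    using attach_not_consecutive[OF l C(1,3) that] by blast
  define X where "X = set P \<inter> attach H"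
  have "card X \<ge> k"
  proof (rule ccontr)
    assume "\<not> k \<le> card X"
    \<comment> \<open>\<open>X\<close> contains every vertex outside \<open>H\<close> adjacent to
      \<open>H\<close>, so \<open>H\<close> is closed in \<open>V - X\<close>. If \<open>X\<close>
      were too small, all of \<open>P\<close> would lie in \<open>X\<close>.\<close>
    then have "H = V - X"
      using C(2,3,4) D(6) by (intro no_small_cut) (auto simp: X_def attach_def)
    then have "set P \<subseteq> attach H" using C(3) D(6) by (auto simp: X_def)
    moreover obtain u w B where "P = [] @ [u, w] @ B"
      using D(1-3) \<open>x \<noteq> y\<close> by (cases P; cases "tl P") auto
    ultimately show False using cons[of "[]" u w B] by auto
  qed
  define S where "S = insert h (succs P (attach H))"
  have pred: False if s: "s \<in> succs P (attach H)" "s \<in> attach H" for s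
    using s(1) cons s(2) by (elim succsE) blast
  have SV: "S \<subseteq> V" using h D(6) succs_subset[of P "attach H"] by (auto simp: S_def)
  have ind: "\<not> E s t" if "s \<in> S" "t \<in> S" for s t
  proof
    assume st: "E s t"
    then have "s \<noteq> t" using E_irrefl by auto
    have "s \<noteq> h" "t \<noteq> h"
      using that pred st C(2) E_sym \<open>s \<noteq> t\<close> by (auto simp: S_def attach_def)
    then have "s \<in> succs P (attach H)" "t \<in> succs P (attach H)"
      using that by (simp_all add: S_def)
    from attach_succs_no_link[OF l C(1,3) this \<open>s \<noteq> t\<close>, of "[]"] st show False by simp
  qed
  \<comment> \<open>The \<open>Suc\<close> is the vertex \<open>h\<close>; it makes up for
    \<open>y\<close>, which has no successor.\<close>
  have cardS: "card S = Suc (card (set (butlast P) \<inter> attach H))"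
    using h succs_subset[of P "attach H"] card_succs[OF D(5)]
    by (subst S_def, subst card_insert_disjoint) (auto simp: finite_succs)
  have setP: "set P = insert y (set (butlast P))"
    using D(1,3) append_butlast_last_id[of P] by (metis list.set(1,2) set_append Un_insert_right sup_bot.right_neutral)
  have "card X \<le> Suc (card (set (butlast P) \<inter> attach H))"
    by (simp add: X_def setP Int_insert_left card_insert_if)
  then have "card S = k" using independent_card_le[OF SV] ind \<open>card X \<ge> k\<close> cardS by fastforce
  have "card X \<le> card S" using \<open>card X \<le> _\<close> cardS by simp
  then have "card X = k" using \<open>card S = k\<close> \<open>card X \<ge> k\<close> by simp
  have "y \<in> attach H"
  proof (rule ccontr)
    assume "y \<notin> attach H"
    then have "X = set (butlast P) \<inter> attach H" by (auto simp: X_def setP)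
    then show False using cardS \<open>card X = k\<close> \<open>card S = k\<close> by simp
  qed
  have only: "h' = h" if h': "h' \<in> V - set P" for h'
  proof (rule ccontr)
    assume "h' \<noteq> h"
    then have "h' \<in> V - S" using h' succs_subset[of P "attach H"] by (auto simp: S_def)
    then obtain a b where ab: "a \<in> S" "b \<in> S" "a \<noteq> b" "E h' a" "E h' b"
      using two_nbrs[OF SV \<open>card S = k\<close> ind] by blast
    \<comment> \<open>One of \<open>a\<close>, \<open>b\<close> differs from \<open>h\<close>. If
      \<open>h'\<close> is in \<open>H\<close>, that one is both a successor and a neighbour of
      \<open>H\<close>; otherwise neither is \<open>h\<close>, and \<open>h'\<close> links two
      successors.\<close>
    show False
    proof (cases "h' \<in> H")
      case True
      then show False using ab pred by (auto simp: S_def attach_def)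
    next
      case False
      then have "\<not> E h' h" using C(2,4) h' E_sym by blast
      then have "a \<in> succs P (attach H)" "b \<in> succs P (attach H)"
        using ab by (auto simp: S_def)
      from attach_succs_no_link[OF l C(1,3) this \<open>a \<noteq> b\<close>, of "[h']"] ab E_sym h' False
      show False by simp
    qed
  qed
  then show P: "set P = V - {h}" using h D(6) by blast
  then have "H = {h}" using C(2,3) by auto
  then have aH: "attach H = nbrs h" by (simp add: attach_singleton)
  then have "X = nbrs h" using P nbrs_subset E_irrefl by (auto simp: X_def)
  then show "card (nbrs h) = k" using \<open>card X = k\<close> by simp
  show "E h y" using \<open>y \<in> attach H\<close> aH by simp
  show "card (insert h (succs P (nbrs h))) = k" using \<open>card S = k\<close> by (simp add: S_def aH)
  show "\<And>s t. \<lbrakk>s \<in> insert h (succs P (nbrs h)); t \<in> insert h (succs P (nbrs h))\<rbrakk> \<Longrightarrow> \<not> E s t"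
    using ind by (simp add: S_def aH)
qed

section \<open>Rerouting through the missed vertex\<close>

lemmas seq_simps = successively_append_iff successively_Cons hd_append hd_rev last_rev

text \<open>In this and the next four lemmas the blocks of \<open>P\<close> are reordered, some of
  them reversed, and \<open>h\<close> is inserted. The edges in \<open>e\<close> are exactly the new
  junctions, so the result contradicts maximality.\<close>

lemma no_ham_rev_rev:
  assumes l: "longest x y P" and h: "h \<in> V - set P" and P: "P = B0 @ B1 @ B2 @ B3"
    and ne: "B0 \<noteq> []" "B1 \<noteq> []" "B2 \<noteq> []" "B3 \<noteq> []"
    and e: "E h (last B0)" "E h (last B1)" "E (hd B1) (last B2)" "E (hd B2) (hd B3)"
  shows False
proof (rule longest_no_extension1[OF l h, of "B0 @ [h] @ rev B1 @ rev B2 @ B3"])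
  show "successively E (B0 @ [h] @ rev B1 @ rev B2 @ B3)"
    using longestD(4)[OF l] ne e E_sym by (auto simp: P seq_simps)
qed (use longestD(2,3)[OF l] ne in \<open>auto simp: P\<close>)

lemma no_ham_rev_swap:
  assumes l: "longest x y P" and h: "h \<in> V - set P" and P: "P = B0 @ B1 @ B2 @ B3"
    and ne: "B0 \<noteq> []" "B1 \<noteq> []" "B2 \<noteq> []" "B3 \<noteq> []"
    and e: "E h (last B0)" "E h (last B2)" "E (hd B1) (hd B2)" "E (last B1) (hd B3)"
  shows False
proof (rule longest_no_extension1[OF l h, of "B0 @ [h] @ rev B2 @ B1 @ B3"])
  show "successively E (B0 @ [h] @ rev B2 @ B1 @ B3)"
    using longestD(4)[OF l] ne e E_sym by (auto simp: P seq_simps)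
qed (use longestD(2,3)[OF l] ne in \<open>auto simp: P\<close>)

lemma no_ham_swap_rev:
  assumes l: "longest x y P" and h: "h \<in> V - set P" and P: "P = B0 @ B1 @ B2 @ B3"
    and ne: "B0 \<noteq> []" "B1 \<noteq> []" "B2 \<noteq> []" "B3 \<noteq> []"
    and e: "E (last B0) (hd B2)" "E h (last B2)" "E h (last B1)" "E (hd B1) (hd B3)"
  shows False
proof (rule longest_no_extension1[OF l h, of "B0 @ B2 @ [h] @ rev B1 @ B3"])
  show "successively E (B0 @ B2 @ [h] @ rev B1 @ B3)"
    using longestD(4)[OF l] ne e E_sym by (auto simp: P seq_simps)
qed (use longestD(2,3)[OF l] ne in \<open>auto simp: P\<close>)

lemma no_ham_rev_then_swap:
  assumes l: "longest x y P" and h: "h \<in> V - set P" and P: "P = B0 @ B1 @ B2 @ B3"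
    and ne: "B0 \<noteq> []" "B1 \<noteq> []" "B2 \<noteq> []" "B3 \<noteq> []"
    and e: "E (last B0) (last B2)" "E (hd B2) (hd B1)" "E h (last B1)" "E h (hd B3)"
  shows False
proof (rule longest_no_extension1[OF l h, of "B0 @ rev B2 @ B1 @ [h] @ B3"])
  show "successively E (B0 @ rev B2 @ B1 @ [h] @ B3)"
    using longestD(4)[OF l] ne e E_sym by (auto simp: P seq_simps)
qed (use longestD(2,3)[OF l] ne in \<open>auto simp: P\<close>)

lemma no_ham_rev3:
  assumes l: "longest x y P" and h: "h \<in> V - set P" and P: "P = B0 @ B1 @ B2 @ B3 @ B4"
    and ne: "B0 \<noteq> []" "B1 \<noteq> []" "B2 \<noteq> []" "B3 \<noteq> []" "B4 \<noteq> []"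
    and e: "E (last B0) (last B2)" "E (hd B2) (last B1)" "E h (hd B1)" "E h (last B3)"
       "E (hd B3) (hd B4)"
  shows False
proof (rule longest_no_extension1[OF l h, of "B0 @ rev B2 @ rev B1 @ [h] @ rev B3 @ B4"])
  show "successively E (B0 @ rev B2 @ rev B1 @ [h] @ rev B3 @ B4)"
    using longestD(4)[OF l] ne e E_sym by (auto simp: P seq_simps)
qed (use longestD(2,3)[OF l] ne in \<open>auto simp: P\<close>)

text \<open>This rerouting picks up \<open>h\<close> but skips \<open>s\<close>. Here
  \<open>s\<close> follows the reversed block; in \<open>exchange_before_rev\<close> it precedes
  it.\<close>

lemma exchange_after_rev:
  assumes l: "longest x y P" and h: "h \<in> V - set P" and P: "P = B0 @ B1 @ [s] @ B2"
    and ne: "B0 \<noteq> []" "B1 \<noteq> []" "B2 \<noteq> []"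
    and e: "E h (last B0)" "E h (last B1)" "E (hd B1) (hd B2)"
  shows "longest x y (B0 @ [h] @ rev B1 @ B2)" "s \<in> V - set (B0 @ [h] @ rev B1 @ B2)"
proof -
  have "successively E (B0 @ [h] @ rev B1 @ B2)"
    using longestD(4)[OF l] ne e E_sym by (auto simp: P seq_simps)
  moreover have "s \<in> V" using longestD(6)[OF l] by (simp add: P)
  moreover have "mset (s # B0 @ [h] @ rev B1 @ B2) = mset (h # P)" by (simp add: P)
  moreover have "hd (B0 @ [h] @ rev B1 @ B2) = x" "last (B0 @ [h] @ rev B1 @ B2) = y"
    using longestD(2,3)[OF l] ne by (auto simp: P)
  ultimately show "longest x y (B0 @ [h] @ rev B1 @ B2)" "s \<in> V - set (B0 @ [h] @ rev B1 @ B2)"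
    using longest_exchange[OF l h, of s "B0 @ [h] @ rev B1 @ B2"] by simp_all
qed

lemma exchange_before_rev:
  assumes l: "longest x y P" and h: "h \<in> V - set P" and P: "P = B0 @ [s] @ B1 @ B2"
    and ne: "B0 \<noteq> []" "B1 \<noteq> []" "B2 \<noteq> []"
    and e: "E h (last B0)" "E h (last B1)" "E (hd B1) (hd B2)"
  shows "longest x y (B0 @ [h] @ rev B1 @ B2)" "s \<in> V - set (B0 @ [h] @ rev B1 @ B2)"
proof -
  have "successively E (B0 @ [h] @ rev B1 @ B2)"
    using longestD(4)[OF l] ne e E_sym by (auto simp: P seq_simps)
  moreover have "s \<in> V" using longestD(6)[OF l] by (simp add: P)
  moreover have "mset (s # B0 @ [h] @ rev B1 @ B2) = mset (h # P)" by (simp add: P)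
  moreover have "hd (B0 @ [h] @ rev B1 @ B2) = x" "last (B0 @ [h] @ rev B1 @ B2) = y"
    using longestD(2,3)[OF l] ne by (auto simp: P)
  ultimately show "longest x y (B0 @ [h] @ rev B1 @ B2)" "s \<in> V - set (B0 @ [h] @ rev B1 @ B2)"
    using longest_exchange[OF l h, of s "B0 @ [h] @ rev B1 @ B2"] by simp_all
qed

section \<open>Adjacencies of the non-neighbours of the missed vertex\<close>

lemma missing_not_consecutive:
  assumes l: "longest x y P" and h: "h \<in> V - set P" and P: "P = A @ [u, w] @ B"
    and u: "E h u" and w: "E h w"
  shows False
  using attach_not_consecutive[OF l linked_singleton[of h] _ P] h u w by (simp add: attach_singleton)

lemma missing_adj_start:
  assumes l: "longest x y P" "x \<noteq> y" "h \<in> V - set P"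
  shows "E h x"
  using longest_missing(3)[OF longest_rev[OF l(1)]] l by simp

text \<open>The vertex \<open>v\<close> has two neighbours in the independent k-set formed by
  \<open>h\<close> and the successors. Neither is \<open>h\<close>, so one of them avoids a
  prescribed \<open>c\<close>.\<close>

lemma missing_other_succ:
  assumes l: "longest x y P" "x \<noteq> y" "h \<in> V - set P"
    and v: "v \<in> V" "v \<noteq> h" "\<not> E h v" "v \<notin> succs P (nbrs h)"
  obtains s where "s \<in> succs P (nbrs h)" "s \<noteq> c" "E v s"
proof -
  let ?S = "insert h (succs P (nbrs h))"
  have "?S \<subseteq> V" using l longestD(6)[OF l(1)] succs_subset[of P "nbrs h"] by auto
  moreover have "v \<in> V - ?S" using v by simp
  ultimately obtain a b where "a \<in> ?S" "b \<in> ?S" "a \<noteq> b" "E v a" "E v b"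
    using two_nbrs[OF _ longest_missing(4)[OF l] longest_missing(5)[OF l]] by meson
  then have "a \<in> succs P (nbrs h)" "b \<in> succs P (nbrs h)" using v(3) E_sym by auto
  then show ?thesis using that \<open>a \<noteq> b\<close> \<open>E v a\<close> \<open>E v b\<close> by metis
qed

text \<open>\<open>M\<close> avoids \<open>X\<close>, so neither \<open>M\<close> itself nor its
  junction with \<open>B\<close> yields a successor; the junction with \<open>A\<close> can yield
  only \<open>hd M\<close>.\<close>

lemma succs_around_segment:
  assumes s: "s \<in> succs (A @ M @ B) X" and "M \<noteq> []" and M: "set M \<inter> X = {}" and "s \<noteq> hd M"
  obtains "s \<in> succs A X" | "s \<in> succs B X"
proof -
  have "last M \<notin> X" using M \<open>M \<noteq> []\<close> last_in_set by blast
  then show ?thesis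
    using s assms(2,4) that succs_disjoint[OF M]
    by (auto simp: succs_append split: if_splits)
qed

lemma not_in_succs:
  assumes d: "distinct P" and P: "P = A @ M @ [u] @ B" and "M \<noteq> []" and M: "set M \<inter> X = {}"
  shows "u \<notin> succs P X"
proof -
  have P': "P = (A @ butlast M) @ [last M, u] @ B"
    using \<open>M \<noteq> []\<close> by (simp add: P)
  have "last M \<notin> X" using M \<open>M \<noteq> []\<close> last_in_set by blast
  then show ?thesis using succs_iff_pred[of "A @ butlast M" "last M" u B X] d
    unfolding P'[symmetric] by simp
qed

text \<open>The vertex \<open>u\<close> has a neighbour \<open>s'\<close> among the successors other
  than \<open>s\<close>. The edges \<open>s w\<close> and \<open>u s'\<close> reattach both ends of
  the block from \<open>s\<close> to \<open>u\<close>, and the path can be rerouted through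
  \<open>h\<close> wherever \<open>s'\<close> lies.\<close>

lemma segment_head_not_adj:
  assumes l: "longest x y P" "x \<noteq> y" "h \<in> V - set P"
    and P: "P = A @ [a, s] @ M @ [u, w] @ B" and a: "E h a"
    and M: "set (s # M @ [u]) \<inter> nbrs h = {}"
  shows "\<not> E s w"
proof
  assume sw: "E s w"
  note D = longestD[OF l(1)]
  have "u \<in> V" "u \<noteq> h" "\<not> E h u" using D(6) l(3) M by (auto simp: P)
  moreover have "u \<notin> succs P (nbrs h)"
    by (rule not_in_succs[OF D(5), of "A @ [a]" "s # M" u "w # B"]) (use M in \<open>auto simp: P\<close>)
  ultimately obtain s' where s': "s' \<in> succs P (nbrs h)" "s' \<noteq> s" "E u s'"
    using missing_other_succ[OF l] by metis
  have P2: "P = (A @ [a]) @ (s # M @ [u]) @ (w # B)" by (simp add: P)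
  show False
  proof (rule succs_around_segment[OF s'(1)[unfolded P2] _ M])
    assume "s' \<in> succs (A @ [a]) (nbrs h)"
    then obtain A1 x' A2 where 1: "A @ [a] = A1 @ [x', s'] @ A2" and x': "x' \<in> nbrs h"
      by (rule succsE)
    have "last (s' # A2) = a" using arg_cong[OF 1, of last] by simp
    moreover have "P = (A1 @ [x']) @ (s' # A2) @ (s # M @ [u]) @ (w # B)"
      unfolding P2 1 by simp
    ultimately show False
      using no_ham_rev_rev[OF l(1,3), of "A1 @ [x']" "s' # A2" "s # M @ [u]" "w # B"]
        x' a s'(3) sw E_sym by simp
  next
    assume "s' \<in> succs (w # B) (nbrs h)"
    then obtain C1 x' C2 where 1: "w # B = C1 @ [x', s'] @ C2" and x': "x' \<in> nbrs h"
      by (rule succsE)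
    have "hd (C1 @ [x']) = w" using arg_cong[OF 1, of hd] by (simp add: hd_append split: if_splits)
    moreover have "P = (A @ [a]) @ (s # M @ [u]) @ (C1 @ [x']) @ (s' # C2)"
      unfolding P2 1 by simp
    ultimately show False
      using no_ham_rev_swap[OF l(1,3), of "A @ [a]" "s # M @ [u]" "C1 @ [x']" "s' # C2"]
        x' a s'(3) sw E_sym by simp
  qed (use s' in simp_all)
qed

section \<open>Segments between neighbours of the missed vertex\<close>

text \<open>Here \<open>s'\<close> follows \<open>b\<close> directly. This case of
  \<open>no_long_segment\<close> is treated apart, since exchanging \<open>h\<close> for
  \<open>s\<close> would leave as many vertices beyond the segment as before and the induction would
  not progress.\<close>

lemma no_segment_step:
  assumes l: "longest x y P" "x \<noteq> y" "h \<in> V - set P"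
    and P: "P = A @ [a, s, v] @ M @ [b] @ B" and a: "E h a" and b: "E h b"
    and seg: "set (s # v # M) \<inter> nbrs h = {}" and sM: "\<And>w. w \<in> set (M @ [b]) \<Longrightarrow> \<not> E s w"
    and B: "B = s' # C" and vs': "E v s'"
  shows False
proof -
  note D = longestD[OF l(1)]
  have P2: "P = (A @ [a]) @ (s # v # M) @ (b # B)" by (simp add: P)
  have sv: "E s v" using D(4) by (auto simp: P seq_simps)
  have as: "E a s" and vhd: "E v (hd (M @ [b]))" and bs': "E b s'"
    using D(4) by (auto simp: P B seq_simps split: if_splits)
  show False
  proof (cases M)
    case Nil
    \<comment> \<open>The segment is just \<open>s\<close>, \<open>v\<close>. On the reversed path
      \<open>s\<close> plays the part of \<open>v\<close>: it has a neighbour \<open>p\<close> other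
      than \<open>v\<close> that directly precedes a neighbour of \<open>h\<close> on
      \<open>P\<close>.\<close>
    have "s \<in> V" "s \<noteq> h" "\<not> E h s" using D(6) l(3) seg by (auto simp: P)
    moreover have "s \<notin> succs (rev P) (nbrs h)"
      by (rule not_in_succs[of "rev P" "rev (b # B)" "[v]" s "rev (A @ [a])"])
        (use D(5) seg Nil in \<open>auto simp: P\<close>)
    ultimately obtain p where p: "p \<in> succs (rev P) (nbrs h)" "p \<noteq> v" "E s p"
      using missing_other_succ[OF longest_rev[OF l(1)], of h s v] l(2,3) by auto
    have P3: "rev P = rev (b # B) @ [v, s] @ rev (A @ [a])" by (simp add: P Nil)
    show False
    proof (rule succs_around_segment[OF p(1)[unfolded P3]])
      assume "p \<in> succs (rev (b # B)) (nbrs h)"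
      then obtain R1 x' R2 where "rev (b # B) = R1 @ [x', p] @ R2" and x': "x' \<in> nbrs h"
        by (rule succsE)
      then have "rev (rev (b # B)) = rev R2 @ [p, x'] @ rev R1" by simp
      then have 1: "b # B = rev R2 @ [p, x'] @ rev R1" by (simp only: rev_rev_ident)
      show False
      proof (cases "rev R2")
        case Nil
        then have "P = (A @ [a, s, v] @ M) @ [b, x'] @ rev R1" using 1 by (simp add: P)
        from missing_not_consecutive[OF l(1,3) this b] x' show False by simp
      next
        case (Cons c B1)
        then have B1: "B = B1 @ [p, x'] @ rev R1" using 1 by simp
        then have "hd (B1 @ [p]) = s'" by (cases B1) (use B in auto)
        moreover have "P = (A @ [a, s]) @ [v, b] @ (B1 @ [p]) @ (x' # rev R1)"
          using B1 by (simp add: P \<open>M = []\<close>)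
        \<comment> \<open>Route: up to \<open>s\<close>, back from \<open>p\<close> to
          \<open>s'\<close>, then \<open>v\<close>, \<open>b\<close>, \<open>h\<close>, on from
          \<open>x'\<close>.\<close>
        ultimately show False
          using no_ham_rev_then_swap[OF l(1,3), of "A @ [a, s]" "[v, b]" "B1 @ [p]" "x' # rev R1"]
            p(3) x' b vs' E_sym by simp
      qed
    next
      assume "p \<in> succs (rev (A @ [a])) (nbrs h)"
      then obtain R1 x' R2 where "rev (A @ [a]) = R1 @ [x', p] @ R2" and x': "x' \<in> nbrs h"
        by (rule succsE)
      then have "rev (rev (A @ [a])) = rev R2 @ [p, x'] @ rev R1" by simp
      then have 1: "A @ [a] = rev R2 @ [p, x'] @ rev R1" by (simp only: rev_rev_ident)
      have "last (x' # rev R1) = a" using arg_cong[OF 1, of last] by simp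
      moreover have "P = (rev R2 @ [p]) @ (x' # rev R1) @ [s] @ [v, b] @ (s' # C)"
        unfolding P2 1 by (simp add: \<open>M = []\<close> B)
      \<comment> \<open>Route: up to \<open>p\<close>, then \<open>s\<close>, back from
        \<open>a\<close> to \<open>x'\<close>, then \<open>h\<close>, \<open>b\<close>,
        \<open>v\<close>, on from \<open>s'\<close>.\<close>
      ultimately show False
        using no_ham_rev3[OF l(1,3), of "rev R2 @ [p]" "x' # rev R1" "[s]" "[v, b]" "s' # C"]
          p(3) x' b vs' as E_sym by simp
    qed (use p seg in auto)
  next
    case (Cons m M')
    \<comment> \<open>With a third vertex \<open>m\<close> in the segment, a second neighbour of
      \<open>m\<close> among the successors supplies the missing edge.\<close>
    have "m \<in> V" "m \<noteq> h" "\<not> E h m" using D(6) l(3) seg by (auto simp: P Cons)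
    moreover have "m \<notin> succs P (nbrs h)"
      by (rule not_in_succs[OF D(5), of "A @ [a, s]" "[v]" m "M' @ [b] @ B"])
        (use seg in \<open>auto simp: P Cons\<close>)
    ultimately obtain t where t: "t \<in> succs P (nbrs h)" "t \<noteq> s'" "E m t"
      using missing_other_succ[OF l] by metis
    have "t \<noteq> s" using sM[of m] t(3) E_sym Cons by auto
    show False
    proof (rule succs_around_segment[OF t(1)[unfolded P2]])
      assume "t \<in> succs (A @ [a]) (nbrs h)"
      then obtain A1 x' A2 where 1: "A @ [a] = A1 @ [x', t] @ A2" and x': "x' \<in> nbrs h"
        by (rule succsE)
      have "P = (A1 @ [x']) @ (t # A2 @ [s, v]) @ (M @ [b]) @ (s' # C)"
        unfolding P2 1 by (simp add: B)
      then show False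
        using no_ham_rev_swap[OF l(1,3), of "A1 @ [x']" "t # A2 @ [s, v]" "M @ [b]" "s' # C"]
          x' b t(3) vs' E_sym Cons by simp
    next
      assume "t \<in> succs (b # B) (nbrs h)"
      then obtain C1 x' C2 where 1: "b # B = C1 @ [x', t] @ C2" and x': "x' \<in> nbrs h"
        by (rule succsE)
      show False
      proof (cases C1)
        case Nil
        then show False using 1 t(2) B by simp
      next
        case (Cons c B1)
        then have B1: "B = B1 @ [x', t] @ C2" using 1 by simp
        then have "hd (B1 @ [x']) = s'" by (cases B1) (use B in auto)
        moreover have "P = (A @ [a, s, v]) @ (M @ [b]) @ (B1 @ [x']) @ (t # C2)"
          using B1 by (simp add: P)
        ultimately show False
          using no_ham_swap_rev[OF l(1,3), of "A @ [a, s, v]" "M @ [b]" "B1 @ [x']" "t # C2"]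
            t(3) x' b vs' \<open>M = m # M'\<close> E_sym by simp
      qed
    qed (use seg \<open>t \<noteq> s\<close> in auto)
  qed
qed

text \<open>Induction on the number of vertices beyond \<open>b\<close>. Exchanging \<open>h\<close>
  for the head \<open>s\<close> of the segment gives a longest path on which neighbours of
  \<open>s\<close> bound a segment of at least two vertices with fewer vertices beyond it.\<close>

lemma no_long_segment:
  assumes "longest x y P" "x \<noteq> y" "h \<in> V - set P"
    and "P = A @ [a] @ M @ [b] @ B" "E h a" "E h b" "2 \<le> length M" "set M \<inter> nbrs h = {}"
  shows False
  using assms
proof (induction "length B" arbitrary: P h A a M b B rule: less_induct)
  case less
  note l = less.prems(1-3) and a = less.prems(5) and b = less.prems(6)
  note D = longestD[OF l(1)]
  obtain s v N where M: "M = s # v # N"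
    using less.prems(7) by (cases M; cases "tl M") auto
  have P: "P = A @ [a, s, v] @ N @ [b] @ B" using less.prems(4) by (simp add: M)
  have P2: "P = (A @ [a]) @ (s # v # N) @ (b # B)" by (simp add: P)
  have seg: "set (s # v # N) \<inter> nbrs h = {}" using less.prems(8) M by simp
  have sV: "s \<in> V" using D(6) by (simp add: P)
  have as: "E a s" and sv: "E s v" using D(4) by (auto simp: P seq_simps split: if_splits)
  have s_succ: "s \<in> succs P (nbrs h)"
    using in_succs[of a "nbrs h" s A "v # N @ [b] @ B"] a by (simp add: P)
  have sN: "\<not> E s w" if w: "w \<in> set (N @ [b])" for w
  proof -
    obtain N1 N2 where N: "N @ [b] = N1 @ w # N2" using split_list[OF w] by (elim exE) (rule that)
    obtain K u where K: "v # N1 = K @ [u]" by (cases "v # N1" rule: rev_cases) auto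
    have "P = A @ [a, s] @ (v # N1) @ w # N2 @ B" using N by (simp add: P)
    then have P3: "P = A @ [a, s] @ K @ [u, w] @ (N2 @ B)" unfolding K by simp
    have "set N1 \<subseteq> set N"
      using N by (cases N2 rule: rev_cases) (auto simp: append_eq_append_conv2)
    then have "set (v # N1) \<inter> nbrs h = {}" using seg by auto
    then show ?thesis
      using segment_head_not_adj[OF l P3 a] seg unfolding K by auto
  qed
  have "v \<in> V" "v \<noteq> h" "\<not> E h v" using D(6) l(3) seg by (auto simp: P)
  moreover have "v \<notin> succs P (nbrs h)"
    by (rule not_in_succs[OF D(5), of "A @ [a]" "[s]" v "N @ [b] @ B"])
      (use seg in \<open>auto simp: P\<close>)
  ultimately obtain s' where s': "s' \<in> succs P (nbrs h)" "s' \<noteq> s" "E v s'"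
    using missing_other_succ[OF l] by metis
  show False
  proof (rule succs_around_segment[OF s'(1)[unfolded P2] _ seg])
    assume "s' \<in> succs (A @ [a]) (nbrs h)"
    then obtain A1 x' A2 where 1: "A @ [a] = A1 @ [x', s'] @ A2" and x': "x' \<in> nbrs h"
      by (rule succsE)
    have la: "last (s' # A2) = a" using arg_cong[OF 1, of last] by simp
    have P3: "P = (A1 @ [x']) @ (s' # A2) @ [s] @ (v # N @ [b] @ B)"
      unfolding P2 1 by simp
    let ?Q = "(A1 @ [x', h] @ rev (s' # A2)) @ [v] @ N @ [b] @ B"
    have l': "longest x y ?Q" "s \<in> V - set ?Q"
      using exchange_after_rev[OF l(1,3) P3] la a x' s'(3) E_sym by simp_all
    \<comment> \<open>The last vertex is adjacent to whatever vertex a longest path misses, so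
      \<open>s\<close> has a neighbour beyond \<open>b\<close>. The first such neighbour closes the
      new segment, which starts after \<open>v\<close>.\<close>
    have "E s y" by (rule longest_missing(3)[OF l'(1) l(2) l'(2)])
    moreover have "y = last (b # B)" using D(3) by (simp add: P)
    ultimately have "B \<noteq> []" "\<exists>z\<in>set B. E s z" using sN[of b] by (auto split: if_splits)
    from split_list_first_prop[OF this(2)] obtain B1 b' B2 where
      B: "B = B1 @ b' # B2" "E s b'" "\<forall>z\<in>set B1. \<not> E s z" by (elim exE bexE conjE) (rule that)
    \<comment> \<open>The vertex after \<open>b\<close> is a successor, like \<open>s\<close>, hence
      not adjacent to \<open>s\<close>; so the new segment is long enough.\<close>
    have "B1 \<noteq> []"
    proof
      assume "B1 = []"
      then have "P = (A @ [a] @ s # v # N) @ [b, b'] @ B2" using B(1) by (simp add: P)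
      then have "b' \<in> succs P (nbrs h)" using in_succs[of b "nbrs h" b' "A @ [a] @ s # v # N" B2] b by simp
      then show False using longest_missing(5)[OF l, of s b'] s_succ B(2) by simp
    qed
    then have len: "2 \<le> length (N @ [b] @ B1)" by (cases B1) auto
    have disj: "set (N @ [b] @ B1) \<inter> nbrs s = {}" using sN B(3) by auto
    have Q: "?Q = (A1 @ [x', h] @ rev (s' # A2)) @ [v] @ (N @ [b] @ B1) @ [b'] @ B2"
      using B(1) by simp
    have "length B2 < length B" using B(1) by simp
    from less.hyps[OF this l'(1) l(2) l'(2) Q sv B(2) len disj] show False .
  next
    assume "s' \<in> succs (b # B) (nbrs h)"
    then obtain C1 x' C2 where 1: "b # B = C1 @ [x', s'] @ C2" and x': "x' \<in> nbrs h"
      by (rule succsE)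
    show False
    proof (cases C1)
      case Nil
      then have "B = s' # C2" using 1 by simp
      then show False using no_segment_step[OF l P a b seg sN _ s'(3)] by simp
    next
      case (Cons c B1)
      then have B: "B = B1 @ [x', s'] @ C2" using 1 by simp
      obtain d B1' where B1: "B1 = d # B1'"
      proof (cases B1)
        case Nil
        then have "P = (A @ [a] @ s # v # N) @ [b, x'] @ (s' # C2)" using B by (simp add: P)
        from missing_not_consecutive[OF l(1,3) this b] x' show ?thesis by simp
      qed
      have sd: "\<not> E s d"
      proof -
        have "P = (A @ [a] @ s # v # N) @ [b, d] @ B1' @ [x', s'] @ C2" using B B1 by (simp add: P)
        then have "d \<in> succs P (nbrs h)" using in_succs[of b "nbrs h" d "A @ [a] @ s # v # N" "B1' @ [x', s'] @ C2"] b by simp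
        then show ?thesis using longest_missing(5)[OF l, of s d] s_succ by simp
      qed
      \<comment> \<open>The new path runs to \<open>a\<close>, then \<open>h\<close>, back from
        \<open>x'\<close> to \<open>v\<close>, on from \<open>s'\<close>. Its segment lies between
        the last neighbour of \<open>s\<close> in \<open>?W\<close> and \<open>v\<close>, and
        contains \<open>d\<close> and \<open>b\<close>.\<close>
      let ?W = "A @ [a, h, x'] @ rev B1'"
      let ?Q = "?W @ [d, b] @ rev N @ [v] @ (s' # C2)"
      have P3: "P = (A @ [a]) @ [s] @ (v # N @ [b] @ B1 @ [x']) @ (s' # C2)"
        using B by (simp add: P)
      have l': "longest x y ?Q" "s \<in> V - set ?Q"
        using exchange_before_rev[OF l(1,3) P3] a x' s'(3) E_sym by (simp_all add: B1)
      have "\<exists>z\<in>set ?W. E s z" using as E_sym by auto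
      from split_list_last_prop[OF this] obtain W1 a' W2 where
        W: "?W = W1 @ a' # W2" "E s a'" "\<forall>z\<in>set W2. \<not> E s z" by (elim exE bexE conjE) (rule that)
      let ?S = "W2 @ [d, b] @ rev N"
      have Q: "?Q = W1 @ [a'] @ ?S @ [v] @ (s' # C2)"
        using arg_cong[OF W(1), of "\<lambda>w. w @ [d, b] @ rev N @ [v] @ (s' # C2)"] by simp
      have disj: "set ?S \<inter> nbrs s = {}" using sN sd W(3) by auto
      have len: "2 \<le> length ?S" by simp
      have "length (s' # C2) < length B" by (simp add: B B1)
      from less.hyps[OF this l'(1) l(2) l'(2) Q W(2) sv len disj] show False .
    qed
  qed (use s' in simp_all)
qed

section \<open>Degrees and the structure of the exceptional graph\<close>

lemma k_le_degree:
  assumes "s \<in> V"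
  shows "k \<le> card (nbrs s)"
proof (rule ccontr)
  assume less: "\<not> k \<le> card (nbrs s)"
  \<comment> \<open>Removing fewer than \<open>k\<close> neighbours would isolate \<open>s\<close>,
    so no further vertex can remain.\<close>
  then have "{s} = V - nbrs s"
    using assms nbrs_subset E_irrefl by (intro no_small_cut) auto
  then have "V \<subseteq> insert s (nbrs s)" by auto
  moreover have "finite (nbrs s)" using nbrs_subset fin by (rule finite_subset)
  ultimately have "card V \<le> card (insert s (nbrs s))" by (intro card_mono) auto
  also have "\<dots> \<le> Suc (card (nbrs s))" by (simp add: card_insert_if \<open>finite (nbrs s)\<close>)
  finally show False using less k_less by simp
qed

lemma exists_longest:
  assumes "x \<in> V" "y \<in> V"
  obtains P where "longest x y P"
proof -
  define r where "r = (\<lambda>a b. E a b \<and> a \<in> V \<and> b \<in> V)"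
  define H where "H = {w. r\<^sup>*\<^sup>* x w}"
  note C = linked_component[OF assms(1) r_def H_def]
  have "H = V - {}" by (rule no_small_cut) (use C k2 in auto)
  then have "linked V" using C(1) by simp
  then obtain R where "path x y R" using assms unfolding linked_def path_def by blast
  moreover have "length Q < Suc (card V)" if "path x y Q" for Q
    using that distinct_card[of Q] card_mono[OF fin, of "set Q"] by (simp add: path_def)
  ultimately obtain P where "path x y P" "\<forall>Q. path x y Q \<longrightarrow> length Q \<le> length P"
    using ex_has_greatest_nat[of "path x y" R length "Suc (card V)"] by blast
  then show ?thesis using that by (simp add: longest_def)
qed

text \<open>Both ends of \<open>P\<close> are neighbours of \<open>h\<close>, so \<open>v\<close>
  lies in a segment bounded by neighbours on both sides. By \<open>no_long_segment\<close> it is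
  alone there.\<close>

lemma non_nbr_in_succs:
  assumes l: "longest x y P" "x \<noteq> y" "h \<in> V - set P"
    and v: "v \<in> set P" "\<not> E h v"
  shows "v \<in> succs P (nbrs h)"
proof -
  note D = longestD[OF l(1)]
  have hx: "E h x" and hy: "E h y" using missing_adj_start[OF l] longest_missing(3)[OF l] by auto
  obtain A B where P: "P = A @ v # B" using split_list[OF v(1)] by (elim exE) (rule that)
  have "A \<noteq> []" using D(2) v(2) hx by (auto simp: P)
  then have hdA: "x \<in> set A" using D(2) by (auto simp: P)
  have "B \<noteq> []" using D(3) v(2) hy by (auto simp: P)
  then have "y \<in> set B" using D(3) by (auto simp: P)
  show ?thesis
  proof (cases "E h (last A)")
    case True
    have "P = butlast A @ [last A, v] @ B" using \<open>A \<noteq> []\<close> by (simp add: P)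
    then show ?thesis using in_succs[of "last A" "nbrs h" v "butlast A" B] True by simp
  next
    case False
    have "\<exists>z\<in>set A. E h z" using hdA hx by auto
    from split_list_last_prop[OF this] obtain A1 a A2 where
      A: "A = A1 @ a # A2" "E h a" "\<forall>z\<in>set A2. \<not> E h z" by (elim exE bexE conjE) (rule that)
    have "\<exists>z\<in>set B. E h z" using \<open>y \<in> set B\<close> hy by auto
    from split_list_first_prop[OF this] obtain B1 b B2 where
      B: "B = B1 @ b # B2" "E h b" "\<forall>z\<in>set B1. \<not> E h z" by (elim exE bexE conjE) (rule that)
    have "A2 \<noteq> []" using False A by auto
    then have len: "2 \<le> length (A2 @ [v] @ B1)" by (cases A2) auto
    have P2: "P = A1 @ [a] @ (A2 @ [v] @ B1) @ [b] @ B2" by (simp add: P A(1) B(1))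
    have "set (A2 @ [v] @ B1) \<inter> nbrs h = {}" using A(3) B(3) v(2) by auto
    from no_long_segment[OF l P2 A(2) B(2) len this] show ?thesis ..
  qed
qed

text \<open>\<open>S\<close> consists of all non-neighbours of \<open>h\<close>, including
  \<open>h\<close>. Independence confines the neighbours of its members to the \<open>k\<close>
  vertices of \<open>V - S\<close>, and the degree bound makes them adjacent to all of
  these.\<close>

lemma missing_structure:
  assumes l: "longest x y P" "x \<noteq> y" "h \<in> V - set P"
  obtains S where "S \<subseteq> V" "card S = k" "card (V - S) = k"
    "\<And>s. s \<in> S \<Longrightarrow> nbrs s = V - S"
proof -
  note D = longestD[OF l(1)] and F = longest_missing[OF l]
  let ?S = "insert h (succs P (nbrs h))"
  have SV: "?S \<subseteq> V" using l(3) D(6) succs_subset[of P "nbrs h"] by auto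
  have in_S: "v \<in> ?S" if "v \<in> V" "\<not> E h v" for v
    using non_nbr_in_succs[OF l, of v] F(1) that by auto
  have N: "V - ?S = nbrs h"
  proof (intro equalityI subsetI)
    fix v assume "v \<in> V - ?S"
    then show "v \<in> nbrs h" using in_S[of v] by auto
  next
    fix v assume v: "v \<in> nbrs h"
    then have "v \<notin> ?S" using F(5)[of h v] by auto
    then show "v \<in> V - ?S" using v nbrs_subset by blast
  qed
  have eq: "nbrs s = nbrs h" if "s \<in> ?S" for s
  proof (rule card_subset_eq)
    show "finite (nbrs h)" using nbrs_subset fin by (rule finite_subset)
    show sub: "nbrs s \<subseteq> nbrs h"
    proof
      fix w assume "w \<in> nbrs s"
      then have "w \<in> V" "w \<notin> ?S" using F(5)[OF that] E_verts2 by auto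
      then show "w \<in> nbrs h" using N by blast
    qed
    have "k \<le> card (nbrs s)" using k_le_degree SV that by blast
    moreover have "card (nbrs s) \<le> k"
      using card_mono[OF \<open>finite (nbrs h)\<close> sub] F(2) by simp
    ultimately show "card (nbrs s) = card (nbrs h)" using F(2) by simp
  qed
  show ?thesis
  proof (rule that[OF SV F(4)])
    show "card (V - ?S) = k" unfolding N by (rule F(2))
    show "nbrs s = V - ?S" if "s \<in> ?S" for s unfolding N using that by (rule eq)
  qed
qed

end

section \<open>The theorem for graphs\<close>

lemma kc_graphI:
  fixes G :: "'a pair_pre_digraph"
  assumes "2 \<le> k" "pair_graph G" "k_connected k G" "st_graph (k + 1) 2 G"
  shows "kc_graph (pverts G) (\<lambda>u v. (u, v) \<in> parcs G) k"
proof -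
  interpret pair_graph G by fact
  show ?thesis
  proof
    show "finite (pverts G)" by (rule pair_finite_verts)
    show "2 \<le> k" by fact
    show "(v, u) \<in> parcs G" if "(u, v) \<in> parcs G" for u v
      using pair_sym_arcs that by (auto simp: symmetric_def sym_def)
    show "(u, u) \<notin> parcs G" for u using pair_no_loops[of "(u, u)"] by auto
    show "u \<in> pverts G" if "(u, v) \<in> parcs G" for u v using that by (rule in_arcsD1)
    show "k < card (pverts G)" using assms(3) by (simp add: k_connected_def)
    show "C = pverts G - X"
      if X: "X \<subseteq> pverts G" "card X < k" and C: "C \<subseteq> pverts G - X" "C \<noteq> {}"
        and closed: "\<And>u w. \<lbrakk>u \<in> C; w \<in> pverts G - X; (u, w) \<in> parcs G\<rbrakk> \<Longrightarrow> w \<in> C" for X C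
    proof
      show "C \<subseteq> pverts G - X" by fact
      let ?H = "with_proj G \<restriction> (pverts G - X)"
      interpret H: wf_digraph ?H by (rule wellformed_induce_subgraph)
      have conn: "Digraph_Component.connected ?H"
        using assms(3) X by (simp add: k_connected_def)
      obtain c where c: "c \<in> C" using C(2) by auto
      show "pverts G - X \<subseteq> C"
      proof
        fix v assume "v \<in> pverts G - X"
        then have "(c, v) \<in> rtrancl_on (verts ?H) ((arcs_ends ?H)\<^sup>s)"
          using conn c C(1) unfolding connected_conv by auto
        then show "v \<in> C"
        proof (induction rule: rtrancl_on_induct)
          case base
          show ?case by (rule c)
        next
          case (step a b)
          then have "(a, b) \<in> parcs G" "b \<in> pverts G - X"
            using pair_sym_arcs
            by (auto simp: symcl_def arcs_ends_def arc_to_ends_def symmetric_def sym_def)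
          then show ?case using closed step by blast
        qed
      qed
    qed
    show "\<exists>a\<in>S. \<exists>b\<in>S. a \<noteq> b \<and> (v, a) \<in> parcs G \<and> (v, b) \<in> parcs G"
      if S: "S \<subseteq> pverts G" "card S = k" "\<And>u w. \<lbrakk>u \<in> S; w \<in> S\<rbrakk> \<Longrightarrow> (u, w) \<notin> parcs G"
        and v: "v \<in> pverts G - S" for S v
    proof (rule ccontr)
      assume neg: "\<not> ?thesis"
      have finS: "finite S" using S(1) pair_finite_verts by (rule finite_subset)
      let ?A = "{a \<in> S. (v, a) \<in> parcs G}"
      let ?H = "with_proj G \<restriction> insert v S"
      have "card (insert v S) = k + 1" using v S(2) finS by simp
      then have "2 \<le> num_edges ?H"
        using assms(4) S(1) v by (simp add: st_graph_def)
      \<comment> \<open>As \<open>S\<close> is independent, each edge of \<open>?H\<close> joins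
        \<open>v\<close> to \<open>S\<close>.\<close>
      have "{{u, w} |u w. u \<rightarrow>\<^bsub>?H\<^esub> w} \<subseteq> (\<lambda>a. {v, a}) ` ?A"
      proof
        fix e assume "e \<in> {{u, w} |u w. u \<rightarrow>\<^bsub>?H\<^esub> w}"
        then obtain u w where e: "e = {u, w}" "(u, w) \<in> arcs_ends ?H" by auto
        then have uw: "(u, w) \<in> parcs G" "u \<in> insert v S" "w \<in> insert v S"
          by (auto simp: arcs_ends_def arc_to_ends_def)
        then have wu: "(w, u) \<in> parcs G" using pair_sym_arcs by (auto simp: symmetric_def sym_def)
        have "u \<noteq> w" using uw(1) pair_no_loops by fastforce
        then consider "u = v" "w \<in> S" | "w = v" "u \<in> S" using uw S(3) by auto
        then show "e \<in> (\<lambda>a. {v, a}) ` ?A" using e(1) uw(1) wu by cases auto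
      qed
      then have "num_edges ?H \<le> card ((\<lambda>a. {v, a}) ` ?A)"
        unfolding num_edges_def using finS by (intro card_mono) auto
      also have "\<dots> \<le> card ?A" using finS by (intro card_image_le) simp
      also have "\<dots> \<le> Suc 0" using neg finS by (subst card_le_Suc0_iff_eq) auto
      finally show False using \<open>2 \<le> num_edges ?H\<close> by simp
    qed
  qed
qed

lemma vwalk_arcs_successively:
  "set (vwalk_arcs p) \<subseteq> R \<longleftrightarrow> successively (\<lambda>u v. (u, v) \<in> R) p"
  by (induction p rule: vwalk_arcs.induct) auto

text \<open>By \<open>nb\<close>, the arcs meeting \<open>S\<close> are precisely those between
  \<open>S\<close> and its complement; \<open>K\<close> holds all other arcs.\<close>

lemma iso_join_edgeless:
  fixes G :: "'a pair_pre_digraph"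
  assumes G: "pair_graph G" and S: "S \<subseteq> pverts G" "card S = k"
    and nb: "\<And>s. s \<in> S \<Longrightarrow> {v. (s, v) \<in> parcs G} = pverts G - S"
  defines "K \<equiv> \<lparr>pverts = pverts G - S, parcs = parcs G \<inter> (pverts G - S) \<times> (pverts G - S)\<rparr>"
  shows "pair_graph K" "digraph_iso G (graph_join (edgeless k) K)"
proof -
  interpret pair_graph G by fact
  have sym: "(v, u) \<in> parcs G" if "(u, v) \<in> parcs G" for u v
    using pair_sym_arcs that by (auto simp: symmetric_def sym_def)
  show "pair_graph K"
    by unfold_locales
      (use pair_finite_verts pair_finite_arcs pair_no_loops sym in
        \<open>auto simp: K_def symmetric_def sym_def\<close>)
  have "finite S" using S(1) pair_finite_verts by (rule finite_subset)
  then obtain f where f: "bij_betw f S {..<k}"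
    using ex_bij_betw_finite_nat[of S] S(2) by (auto simp: atLeast0LessThan)
  define g where "g v = (if v \<in> S then Inl (f v) else Inr v)" for v
  have inj: "inj_on g (pverts G)"
    using bij_betw_imp_inj_on[OF f] by (auto simp: g_def inj_on_def)
  have fS: "f ` S = {..<k}" using bij_betw_imp_surj_on[OF f] .
  have S_arc: "(s, v) \<in> parcs G \<longleftrightarrow> v \<in> pverts G \<and> v \<notin> S" if "s \<in> S" for s v
    using nb[OF that] by blast
  have S_arc2: "(v, s) \<in> parcs G \<longleftrightarrow> v \<in> pverts G \<and> v \<notin> S" if "s \<in> S" for s v
    using S_arc[OF that, of v] sym by blast
  \<comment> \<open>Arcs are pairs of vertices, so they are mapped componentwise and the projections
    remain tail and head.\<close>
  let ?i = "\<lparr>iso_verts = g, iso_arcs = map_prod g g, iso_head = snd, iso_tail = fst\<rparr>"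
  have "digraph_isomorphism ?i"
    unfolding digraph_isomorphism_def
  proof (intro conjI ballI)
    show "wf_digraph (with_proj G)" by unfold_locales
    have "inj_on (map_prod g g) (pverts G \<times> pverts G)" using inj by (rule map_prod_inj_on) fact
    then show "inj_on (iso_arcs ?i) (parcs G)"
      by (simp, rule inj_on_subset) (auto dest: in_arcsD1 in_arcsD2)
  qed (use inj in auto)
  moreover have "with_proj (graph_join (edgeless k) K) = app_iso ?i (with_proj G)"
  proof (rule pre_digraph.equality)
    have "pverts G = S \<union> (pverts G - S)" using S(1) by auto
    then have "g ` pverts G = g ` S \<union> g ` (pverts G - S)" by (metis image_Un)
    also have "g ` S = Inl ` {..<k}" using fS by (auto simp: g_def)
    also have "g ` (pverts G - S) = Inr ` (pverts G - S)" by (auto simp: g_def)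
    finally show "verts (with_proj (graph_join (edgeless k) K)) = verts (app_iso ?i (with_proj G))"
      by (simp add: graph_join_def edgeless_def K_def Plus_def)
    have "map_prod g g ` parcs G = parcs (graph_join (edgeless k) K)"
    proof (intro equalityI subsetI)
      fix e assume "e \<in> map_prod g g ` parcs G"
      then obtain u v where uv: "(u, v) \<in> parcs G" "e = (g u, g v)" by auto
      moreover have "u \<in> pverts G" "v \<in> pverts G" using uv(1) by (auto dest: in_arcsD1 in_arcsD2)
      ultimately show "e \<in> parcs (graph_join (edgeless k) K)"
        using fS S_arc[of u v] S_arc2[of v u]
        by (cases "u \<in> S"; cases "v \<in> S") (auto simp: g_def graph_join_def edgeless_def K_def)
    next
      fix e assume "e \<in> parcs (graph_join (edgeless k) K)"
      then consider u v where "e = (Inr u, Inr v)" "(u, v) \<in> parcs G" "u \<notin> S" "v \<notin> S"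
        | u v where "e = (Inl u, Inr v)" "u < k" "v \<in> pverts G" "v \<notin> S"
        | u v where "e = (Inr v, Inl u)" "u < k" "v \<in> pverts G" "v \<notin> S"
        by (auto simp: graph_join_def edgeless_def K_def)
      then show "e \<in> map_prod g g ` parcs G"
      proof cases
        case 1
        then show ?thesis by (intro image_eqI[of _ _ "(u, v)"]) (auto simp: g_def)
      next
        case 2
        then obtain s where "s \<in> S" "f s = u" using fS by (metis imageE lessThan_iff)
        then show ?thesis using 2 S_arc
          by (intro image_eqI[of _ _ "(s, v)"]) (auto simp: g_def)
      next
        case 3
        then obtain s where "s \<in> S" "f s = u" using fS by (metis imageE lessThan_iff)
        then show ?thesis using 3 S_arc2
          by (intro image_eqI[of _ _ "(v, s)"]) (auto simp: g_def)
      qed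
    qed
    then show "arcs (with_proj (graph_join (edgeless k) K)) = arcs (app_iso ?i (with_proj G))"
      by simp
  qed simp_all
  ultimately show "digraph_iso G (graph_join (edgeless k) K)"
    unfolding digraph_iso_def by blast
qed

theorem theorem2:
  fixes k :: nat and G :: "'a pair_pre_digraph"
  assumes "k \<ge> 2"
    and "pair_graph G"
    and "k_connected k G"
    and "st_graph (k + 1) 2 G"
  shows "hamiltonian_connected G \<or>
    (\<exists>G\<^sub>k :: 'a pair_pre_digraph. pair_graph G\<^sub>k \<and> card (pverts G\<^sub>k) = k \<and>
       digraph_iso G (graph_join (edgeless k) G\<^sub>k))"
proof (cases "hamiltonian_connected G")
  case False
  interpret kc_graph "pverts G" "\<lambda>u v. (u, v) \<in> parcs G" k
    using assms by (rule kc_graphI)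
  obtain x y where xy: "x \<in> pverts G" "y \<in> pverts G" "x \<noteq> y"
    and no: "\<nexists>p. vpath p G \<and> hd p = x \<and> last p = y \<and> set p = pverts G"
    using False by (auto simp: hamiltonian_connected_def)
  obtain P where P: "longest x y P" using exists_longest[OF xy(1,2)] .
  note D = longestD[OF P]
  have "vpath P G"
    using D by (auto simp: vpath_def vwalk_def vwalk_arcs_successively)
  then obtain h where "h \<in> pverts G - set P" using no D(2,3,6) by auto
  then obtain S where S: "S \<subseteq> pverts G" "card S = k" "card (pverts G - S) = k"
    "\<And>s. s \<in> S \<Longrightarrow> nbrs s = pverts G - S"
    using missing_structure[OF P xy(3)] by metis
  \<comment> \<open>The witness is the subgraph of \<open>G\<close> induced on the \<open>k\<close>
    vertices outside \<open>S\<close>.\<close>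
  from iso_join_edgeless[OF assms(2) S(1,2) S(4)[unfolded nbrs_def]] S(3)
  show ?thesis by (intro disjI2 exI conjI) auto
qed simp

end
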